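(* Let $M \ge 16$ be an integer with $M \equiv 0 \pmod 8$. Then no AP-free linear order $\prec$ of the integer interval $(M, 2M]$ satisfies all three of the conditions $A_1\colon 2M-5 \prec M+5$; $A_2\colon 2M-3 \prec M+6$; $A_3\colon 2M-10 \prec M+3$.
   Context: $(M,2M]$ denotes the set of integers $\{M+1, \dots, 2M\}$, and $u \prec v$ means that $u$ comes before $v$. A linear order $\prec$ of a set of integers is AP-free if for every three-term arithmetic progression $a<b<c$ (with $c = 2b-a$) inside the set, neither $a \prec b \prec c$ nor $c \prec b \prec a$ holds. *)

theory Defs
  imports Main
begin

text \<open>
  The library predicate \<open>strict_linear_order_on A r\<close> does not confine \<open>r\<close> to \<open>A\<close>;
  the conjunct \<open>r \<subseteq> A \<times> A\<close> makes \<open>r\<close> a relation on \<open>A\<close> alone.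
  A pair \<open>(u, v) \<in> r\<close> means that \<open>u\<close> comes before \<open>v\<close>.
\<close>

definition linear_ordering_of :: "int set \<Rightarrow> int rel \<Rightarrow> bool" where
  "linear_ordering_of A r \<longleftrightarrow> r \<subseteq> A \<times> A \<and> strict_linear_order_on A r"

definition AP_free_on :: "int set \<Rightarrow> int rel \<Rightarrow> bool" where
  "AP_free_on A r \<longleftrightarrow>
    (\<forall>a\<in>A. \<forall>b\<in>A. \<forall>c\<in>A. a < b \<and> b < c \<and> c = 2 * b - a \<longrightarrow>
      \<not> ((a, b) \<in> r \<and> (b, c) \<in> r) \<and> \<not> ((c, b) \<in> r \<and> (b, a) \<in> r))"

end

theory Submission
  imports Defs
begin

text \<open>
  Along a progression with difference \<open>s\<close> the terms alternate between coming before and coming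
  after both neighbours, so of the residue classes \<open>a\<close> and \<open>a + s\<close> modulo \<open>2 * s\<close> one is first
  at distance \<open>s\<close>. Combined with the same dichotomy for \<open>2 * s\<close>, this propagates to odd multiples
  of \<open>s\<close>: an element \<open>a\<close> of the first class precedes \<open>b\<close> if \<open>2 * b - a\<close> is in the interval, and
  also if \<open>2 * a - b\<close> is and \<open>a\<close> is moreover first for \<open>2 * s\<close>. Hence, if \<open>b\<close> precedes two elements
  near the centre of the interval that are first for \<open>s\<close> and differ by an odd multiple of \<open>2 * s\<close>,
  there is a contradiction, since one of these two is first for \<open>2 * s\<close>. Each
  choice of first classes for \<open>s = 1, 2, 4\<close> turns the three conditions into such a configuration.
\<close>

section \<open>The order on a convex set and reflection in a midpoint\<close>

locale ap_free_order =
  fixes A :: "int set" and r :: "int rel"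
  assumes order: "linear_ordering_of A r"
    and ap_free: "AP_free_on A r"
    and convex: "\<lbrakk>x \<in> A; y \<in> A; x \<le> z; z \<le> y\<rbrakk> \<Longrightarrow> z \<in> A"
begin

abbreviation prec :: "int \<Rightarrow> int \<Rightarrow> bool" (infix "\<prec>" 50)
  where "x \<prec> y \<equiv> (x, y) \<in> r"

lemma prec_trans [trans]: "x \<prec> y \<Longrightarrow> y \<prec> z \<Longrightarrow> x \<prec> z"
  using order unfolding linear_ordering_of_def strict_linear_order_on_def by (blast dest: transD)

lemma prec_asym: "x \<prec> y \<Longrightarrow> \<not> y \<prec> x"
  using order prec_trans unfolding linear_ordering_of_def strict_linear_order_on_def irrefl_def
  by blast

lemma prec_total: "\<lbrakk>x \<in> A; y \<in> A; x \<noteq> y\<rbrakk> \<Longrightarrow> x \<prec> y \<or> y \<prec> x"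
  using order unfolding linear_ordering_of_def strict_linear_order_on_def total_on_def by blast

text \<open>AP-freeness with a signed difference \<open>d\<close>, so that later arguments need not
  distinguish increasing from decreasing progressions.\<close>

lemma centre_not_between:
  assumes "y \<in> A" "y + d \<in> A" "y - d \<in> A" "y - d \<prec> y"
  shows "\<not> y \<prec> y + d"
proof
  assume *: "y \<prec> y + d"
  have ap: "\<not> (a \<prec> b \<and> b \<prec> c) \<and> \<not> (c \<prec> b \<and> b \<prec> a)"
    if "a \<in> A" "b \<in> A" "c \<in> A" "a < b" "c = 2 * b - a" for a b c
    using ap_free that unfolding AP_free_on_def by force
  consider "d = 0" | "d > 0" | "d < 0" by linarith
  then show False
  proof cases
    case 1 then show False using * prec_asym by fastforce
  next
    case 2
    then have "y - d < y" "y + d = 2 * y - (y - d)" by simp_all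
    from ap[OF assms(3,1,2) this] show False using assms(4) * by blast
  next
    case 3
    then have "y + d < y" "y - d = 2 * y - (y + d)" by simp_all
    from ap[OF assms(2,1,3) this] show False using assms(4) * by blast
  qed
qed

lemma centre_first_iff:
  assumes "y \<in> A" "y + d \<in> A" "y - d \<in> A"
  shows "y \<prec> y + d \<longleftrightarrow> y \<prec> y - d"
proof (cases "d = 0")
  case False
  then show ?thesis
    using assms centre_not_between[of y d] centre_not_between[of y "- d"]
      prec_total[of y "y + d"] prec_total[of y "y - d"] prec_asym by fastforce
qed simp

lemma centre_last_iff:
  assumes "y \<in> A" "y + d \<in> A" "y - d \<in> A"
  shows "y + d \<prec> y \<longleftrightarrow> y - d \<prec> y"
proof (cases "d = 0")
  case False
  then show ?thesis
    using assms centre_first_iff[OF assms] prec_total[of y "y + d"] prec_total[of y "y - d"]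
      prec_asym by fastforce
qed simp

lemma reflect_first:
  assumes "y \<prec> x" "x \<in> A" "y \<in> A" "x' \<in> A" "x + x' = 2 * y"
  shows "y \<prec> x'"
proof -
  have "y + (x - y) = x" "y - (x - y) = x'" using assms by auto
  then show ?thesis using centre_first_iff[of y "x - y"] assms by metis
qed

lemma reflect_last:
  assumes "x \<prec> y" "x \<in> A" "y \<in> A" "x' \<in> A" "x + x' = 2 * y"
  shows "x' \<prec> y"
proof -
  have "y + (x - y) = x" "y - (x - y) = x'" using assms by auto
  then show ?thesis using centre_last_iff[of y "x - y"] assms by metis
qed

section \<open>First classes along a progression\<close>

lemma progression_mem:
  assumes "a + s * p \<in> A" "a + s * q \<in> A" "p \<le> i" "i \<le> q"
  shows "a + s * i \<in> A"
proof (cases "s \<ge> 0")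
  case True
  then have "s * p \<le> s * i" "s * i \<le> s * q" using assms by (simp_all add: mult_left_mono)
  then show ?thesis using convex[OF assms(1,2)] by simp
next
  case False
  then have "s * i \<le> s * p" "s * q \<le> s * i" using assms by (simp_all add: mult_left_mono_neg)
  then show ?thesis using convex[OF assms(2,1)] by simp
qed

text \<open>\<open>a\<close> only represents its residue class modulo \<open>2 * s\<close> and need
  not lie in \<open>A\<close>; neighbours outside \<open>A\<close> are ignored. Negative
  \<open>s\<close> is allowed, so a mirrored argument is the same lemma at
  \<open>- s\<close>.\<close>

definition first_class :: "int \<Rightarrow> int \<Rightarrow> bool" where
  "first_class s a \<longleftrightarrow> (\<forall>x\<in>A. 2 * s dvd x - a \<longrightarrow>
     (x + s \<in> A \<longrightarrow> x \<prec> x + s) \<and> (x - s \<in> A \<longrightarrow> x \<prec> x - s))"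

lemma first_class_uminus [simp]: "first_class (- s) a = first_class s a"
  unfolding first_class_def by auto

lemma first_class_cong:
  assumes "2 * s dvd a - b"
  shows "first_class s a = first_class s b"
proof -
  have "2 * s dvd x - a \<longleftrightarrow> 2 * s dvd x - b" for x
    using dvd_add_right_iff[OF assms, of "x - a"] by (simp add: algebra_simps)
  then show ?thesis unfolding first_class_def by simp
qed

lemma first_class_shift: "first_class s (a + 2 * s * k) = first_class s a"
  by (rule first_class_cong) simp

lemma first_classD: "\<lbrakk>first_class s a; a \<in> A; a + s \<in> A\<rbrakk> \<Longrightarrow> a \<prec> a + s"
  unfolding first_class_def by auto

text \<open>Each induction step reflects twice: in the odd term \<open>?p 1\<close> to bring
  \<open>?p 2\<close> before it, then in \<open>?p 2\<close> to reach \<open>?p 3\<close>.\<close>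

lemma first_along_progression:
  assumes "x \<in> A" "x + s \<in> A \<Longrightarrow> x \<prec> x + s" "x - s \<in> A \<Longrightarrow> x \<prec> x - s"
  shows "x + s * (2 * int n) \<in> A \<Longrightarrow>
    (x + s * (2 * int n + 1) \<in> A \<longrightarrow> x + s * (2 * int n) \<prec> x + s * (2 * int n + 1)) \<and>
    (x + s * (2 * int n - 1) \<in> A \<longrightarrow> x + s * (2 * int n) \<prec> x + s * (2 * int n - 1))"
proof (induction n)
  case 0
  then show ?case using assms by simp
next
  case (Suc n)
  let ?p = "\<lambda>i. x + s * (2 * int n + i)"
  have x: "x + s * 0 \<in> A" using assms by simp
  have 2: "?p 2 \<in> A" using Suc.prems by (simp add: algebra_simps)
  have 0: "?p 0 \<in> A" and 1: "?p 1 \<in> A"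
    using progression_mem[OF x 2] by simp_all
  have "?p 0 \<prec> ?p 1" using Suc.IH 0 1 by simp
  then have down: "?p 2 \<prec> ?p 1"
    by (rule reflect_last[OF _ 0 1 2]) (simp add: algebra_simps)
  have "?p 2 \<prec> ?p 3" if "?p 3 \<in> A"
    by (rule reflect_first[OF down 1 2 that]) (simp add: algebra_simps)
  with down show ?case by (simp add: algebra_simps)
qed

text \<open>Alternation spreads the one given comparison through the whole class, in one direction
  with \<open>s\<close> and in the other with \<open>- s\<close>.\<close>

lemma first_classI:
  assumes "x \<in> A" "x + s \<in> A" "x \<prec> x + s"
  shows "first_class s x"
  unfolding first_class_def
proof (intro ballI impI)
  fix y assume y: "y \<in> A" and dvd: "2 * s dvd y - x"
  from dvd obtain k where k: "y - x = 2 * s * k" by (rule dvdE)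
  have down: "x - s \<in> A \<Longrightarrow> x \<prec> x - s"
    using reflect_first[OF assms(3,2,1)] by simp
  show "(y + s \<in> A \<longrightarrow> y \<prec> y + s) \<and> (y - s \<in> A \<longrightarrow> y \<prec> y - s)"
  proof (cases "k \<ge> 0")
    case True
    then have "y = x + s * (2 * int (nat k))" using k by simp
    then show ?thesis
      using first_along_progression[of x s "nat k"] assms down y by (simp add: algebra_simps)
  next
    case False
    then obtain n where "- k = int n" using zero_le_imp_eq_int[of "- k"] by auto
    then have k': "k = - int n" by simp
    then have eq: "y = x - s * (2 * int n)" using k by (simp add: algebra_simps)
    show ?thesis
      using first_along_progression[of x "- s" n] assms down y unfolding eq
      by (simp add: algebra_simps)
  qed
qed

text \<open>If the class of \<open>a\<close> fails at some \<open>x\<close> against a neighbour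
  \<open>x + e\<close>, then \<open>x + e\<close> precedes \<open>x\<close>, and this single
  comparison makes the other class first.\<close>

lemma first_class_dichotomy:
  assumes "s \<noteq> 0"
  shows "first_class s a \<or> first_class s (a + s)"
proof (cases "first_class s a")
  case False
  then obtain x e where x: "x \<in> A" "2 * s dvd x - a" "e = s \<or> e = - s" "x + e \<in> A" "\<not> x \<prec> x + e"
    unfolding first_class_def by fastforce
  then have "x + e \<prec> x" using prec_total[of x "x + e"] assms by auto
  then have "first_class (- e) (x + e)" using x by (intro first_classI) auto
  then have "first_class s (x + e)" using x by auto
  moreover have "2 * s dvd (x + e) - (a + s)"
  proof -
    have "(x + e) - (a + s) = (x - a) + (e - s)" by simp
    moreover have "2 * s dvd e - s" using x(3) by auto
    ultimately show ?thesis using x(2) by (metis dvd_add)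
  qed
  ultimately show ?thesis using first_class_cong by blast
qed simp

lemma first_class_dichotomy_odd:
  assumes "s \<noteq> 0" "odd q"
  shows "first_class s a \<or> first_class s (a + s * q)"
proof -
  obtain k where "q = 2 * k + 1" using \<open>odd q\<close> by (rule oddE)
  then have "a + s * q = a + s + 2 * s * k" by (simp add: algebra_simps)
  then show ?thesis using first_class_dichotomy[OF assms(1)] first_class_shift by metis
qed

section \<open>Comparisons at odd multiples of the difference\<close>

text \<open>The point \<open>a\<close> and its mirror image in the target differ by an odd multiple
  of \<open>2 * s\<close>, so one of them is first for \<open>2 * s\<close>. A step of that length
  towards the target leaves a shorter odd distance for the induction hypothesis, which is needed at
  other starting points and at \<open>- s\<close>.\<close>

lemma first_end_nat:
  assumes "first_class s a" "s \<noteq> 0" "a \<in> A" "a + s * (2 * (2 * int n + 1)) \<in> A"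
  shows "a \<prec> a + s * (2 * int n + 1)"
  using assms
proof (induction n arbitrary: a s)
  case 0
  then have "a + s * 0 \<in> A" "a + s * 2 \<in> A" by simp_all
  then have "a + s * 1 \<in> A" by (rule progression_mem) simp_all
  then show ?case using 0 first_classD[of s a] by simp
next
  case (Suc n)
  define q where "q = 2 * int n + 3"
  have q: "q \<ge> 3" "odd q" "2 * int (Suc n) + 1 = q" by (auto simp: q_def)
  have mem: "a + s * i \<in> A" if "0 \<le> i" "i \<le> 2 * q" for i
  proof (rule progression_mem[OF _ _ that])
    show "a + s * 0 \<in> A" using Suc.prems by simp
    show "a + s * (2 * q) \<in> A" using Suc.prems(4) unfolding q(3) .
  qed
  consider "first_class (2 * s) a" | "first_class (2 * s) (a + 2 * s * q)"
    using first_class_dichotomy_odd[of "2 * s" q a] q(2) Suc.prems(2) by auto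
  then show ?case
  proof cases
    case 1
    have "a \<prec> a + 2 * s" using first_classD[OF 1] Suc.prems mem[of 2] q by (simp add: mult.commute)
    also have "a + 2 * s \<prec> a + 2 * s + s * (2 * int n + 1)"
    proof (rule Suc.IH)
      show "s \<noteq> 0" by (fact Suc.prems(2))
      show "first_class s (a + 2 * s)"
        using Suc.prems(1) first_class_shift[of s a 1] by simp
      show "a + 2 * s \<in> A" using mem[of 2] q by (simp add: mult.commute)
      show "a + 2 * s + s * (2 * (2 * int n + 1)) \<in> A"
        using mem[of "2 + (2 * (2 * int n + 1))"] q_def by (simp add: algebra_simps)
    qed
    finally show ?thesis by (simp add: algebra_simps)
  next
    case 2
    \<comment> \<open>The reflection of \<open>a\<close> in the target point is first for \<open>2 * s\<close>; walk back from there.\<close>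
    define c where "c = a + s * (2 * q)"
    have c: "first_class (2 * s) c" "c \<in> A"
      using 2 mem[of "2 * q"] q by (auto simp: c_def algebra_simps)
    have c2: "c + - (2 * s) \<in> A"
      using mem[of "2 * q - 2"] q by (simp add: c_def algebra_simps)
    have "c \<prec> c + - (2 * s)" using first_classD[of "- (2 * s)" c] c c2
      by (simp only: first_class_uminus)
    also have "c + - (2 * s) \<prec> c + - (2 * s) + - s * (2 * int n + 1)"
    proof (rule Suc.IH)
      show "first_class (- s) (c + - (2 * s))"
        using Suc.prems(1) first_class_shift[of s a "q - 1"] by (simp add: c_def algebra_simps)
      show "c + - (2 * s) + - s * (2 * (2 * int n + 1)) \<in> A"
        using mem[of 2] by (simp add: c_def q_def algebra_simps)
    qed (use c2 Suc.prems in auto)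
    also have "c + - (2 * s) + - s * (2 * int n + 1) = a + s * q"
      by (simp add: c_def q_def algebra_simps)
    finally have "c \<prec> a + s * q" .
    then have "a \<prec> a + s * q"
      using Suc.prems mem[of q] q c
      by (intro reflect_last[of c "a + s * q" a]) (auto simp: c_def algebra_simps)
    then show ?thesis using q by simp
  qed
qed

lemma first_end:
  assumes "first_class s a" "s \<noteq> 0" "odd q" "a \<in> A" "a + s * (2 * q) \<in> A"
  shows "a \<prec> a + s * q"
proof (cases "q \<ge> 0")
  case True
  from \<open>odd q\<close> obtain k where "q = 2 * k + 1" by (rule oddE)
  with True have "q = 2 * int (nat k) + 1" by simp
  then show ?thesis using first_end_nat[of s a "nat k"] assms by simp
next
  case False
  from \<open>odd q\<close> obtain k where "q = 2 * k + 1" by (rule oddE)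
  with False obtain n where "- k - 1 = int n" using zero_le_imp_eq_int[of "- k - 1"] by auto
  with \<open>q = 2 * k + 1\<close> have eq: "q = - (2 * int n + 1)" by simp
  show ?thesis using first_end_nat[of "- s" a n] assms unfolding eq by (simp add: algebra_simps)
qed

text \<open>\<open>first_end\<close> reaches the mirror image \<open>a - s * q\<close>; reflection
  in \<open>a\<close> then gives the target.\<close>

lemma first_inner:
  assumes "first_class s a" "s \<noteq> 0" "odd q"
    and "a \<in> A" "a + s * q \<in> A" "a - s * q \<in> A" "a - s * (2 * q) \<in> A"
  shows "a \<prec> a + s * q"
proof -
  have "a \<prec> a + (- s) * q"
    using assms by (intro first_end) auto
  then show ?thesis using assms by (intro reflect_first[of a "a - s * q" "a + s * q"]) auto
qed

text \<open>Continue from \<open>w\<close> by \<open>first_inner\<close> over the remaining odd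
  distance \<open>p\<close>. The bound \<open>q \<le> 6 * i\<close> keeps
  \<open>w - s * (2 * p)\<close> within distance \<open>s * q\<close> of \<open>a\<close>.\<close>

lemma first_centre_step:
  assumes a: "first_class s a" "s \<noteq> 0" "odd q" "a + s * q \<in> A" "a - s * q \<in> A"
    and i: "0 \<le> i" "q \<le> 6 * i" "2 * i \<le> q"
    and to: "a \<prec> a + s * (2 * i)"
  shows "a \<prec> a + s * q"
proof -
  define w p where "w = a + s * (2 * i)" and "p = q - 2 * i"
  have mem: "a + s * n \<in> A" if "- q \<le> n" "n \<le> q" for n
    using progression_mem[of a s "- q" q n] a that by simp
  have "w \<prec> w + s * p"
  proof (rule first_inner)
    show "first_class s w" using a(1) first_class_shift[of s a i] by (simp add: w_def mult.assoc mult.left_commute)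
    show "s \<noteq> 0" "odd p" using a by (simp_all add: p_def)
    show "w \<in> A" using mem[of "2 * i"] i by (simp add: w_def)
    show "w + s * p \<in> A" using mem[of q] i by (simp add: w_def p_def algebra_simps)
    show "w - s * p \<in> A" using mem[of "4 * i - q"] i by (simp add: w_def p_def algebra_simps)
    show "w - s * (2 * p) \<in> A" using mem[of "6 * i - 2 * q"] i by (simp add: w_def p_def algebra_simps)
  qed
  moreover have "w + s * p = a + s * q" by (simp add: w_def p_def algebra_simps)
  ultimately show ?thesis using to prec_trans unfolding w_def by metis
qed

text \<open>
  Reaching \<open>a + s * q\<close> from the centre \<open>a\<close> needs an odd multiple \<open>2 * s * i\<close> of \<open>2 * s\<close> with
  \<open>q / 6 \<le> i \<le> q / 2\<close> and \<open>a\<close> before \<open>a + 2 * s * i\<close>, while \<open>first_end\<close> gives only \<open>i \<le> q / 4\<close>.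
  The range \<open>[q / 6, q / 4]\<close> may contain no odd integer, so one step of length \<open>4 * s\<close> is added; by
  symmetry about \<open>a\<close> it may be assumed to go away from \<open>a\<close>.
\<close>

lemma first_centre_two_steps:
  assumes a: "first_class s a" "first_class (2 * s) a" "s \<noteq> 0" "odd q" "a + s * q \<in> A" "a - s * q \<in> A"
    and j: "odd j" "0 < j" "4 * j \<le> q" "q < 4 * j + 8" "7 \<le> q"
    and w: "first_class (4 * s) (a + s * (2 * j))"
  shows "a \<prec> a + s * q"
proof (rule first_centre_step[of s a q "j + 2"])
  have mem: "a + s * n \<in> A" if "- q \<le> n" "n \<le> q" for n
    using progression_mem[of a s "- q" q n] a that by simp
  have le: "2 * j + 4 \<le> q"
    using j by presburger
  have "a \<prec> a + (2 * s) * j"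
  proof (rule first_end)
    show "a \<in> A" using mem[of 0] j by simp
    show "a + 2 * s * (2 * j) \<in> A" using mem[of "4 * j"] j by (simp add: mult.assoc mult.left_commute)
  qed (use a j in auto)
  also have "a + (2 * s) * j = a + s * (2 * j)" by simp
  also have "a + s * (2 * j) \<prec> a + s * (2 * j) + 4 * s"
  proof (rule first_classD[OF w])
    show "a + s * (2 * j) \<in> A" using mem[of "2 * j"] j by simp
    show "a + s * (2 * j) + 4 * s \<in> A" using mem[of "2 * j + 4"] j le by (simp add: algebra_simps)
  qed
  finally show "a \<prec> a + s * (2 * (j + 2))" by (simp add: algebra_simps)
  show "2 * (j + 2) \<le> q" using le by simp
qed (use a j in auto)

lemma first_centre_pos:
  assumes a: "first_class s a" "first_class (2 * s) a" "s \<noteq> 0" "odd q" "a + s * q \<in> A" "a - s * q \<in> A"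
    and q: "0 < q"
  shows "a \<prec> a + s * q"
proof -
  have mem: "a + s * n \<in> A" if "- q \<le> n" "n \<le> q" for n
    using progression_mem[of a s "- q" q n] a that by simp
  have "a \<in> A" using mem[of 0] q by simp
  have "q = 1 \<or> (q = 3 \<or> q = 5) \<or> q \<ge> 7" using q \<open>odd q\<close> by presburger
  then consider "q = 1" | "q = 3 \<or> q = 5" | "q \<ge> 7" by blast
  then show ?thesis
  proof cases
    case 1
    then show ?thesis using first_classD[OF a(1) \<open>a \<in> A\<close>] a by simp
  next
    case 2
    then have "a + 2 * s \<in> A" using mem[of 2] by (auto simp: mult.commute)
    from first_classD[OF a(2) \<open>a \<in> A\<close> this] have "a \<prec> a + s * (2 * 1)" by (simp add: mult.commute)
    then show ?thesis using a 2 by (intro first_centre_step[of s a q 1]) auto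
  next
    case 3
    \<comment> \<open>The largest odd \<open>j\<close> with \<open>4 * j \<le> q\<close>.\<close>
    define j where "j = 2 * ((q - 4) div 8) + 1"
    have j: "odd j" "0 < j" "4 * j \<le> q" "q < 4 * j + 8"
      using 3 by (auto simp: j_def)
    \<comment> \<open>The points at distance \<open>2 * s * j\<close> on either side of
      \<open>a\<close> differ by an odd multiple of \<open>4 * s\<close>; if only the one at
      \<open>- s\<close> is first, argue there and reflect in \<open>a\<close>.\<close>
    have "first_class (4 * s) (a - s * (2 * j)) \<or> first_class (4 * s) (a - s * (2 * j) + 4 * s * j)"
      using first_class_dichotomy_odd[of "4 * s" j "a - s * (2 * j)"] a(3) j(1) by simp
    then consider "first_class (4 * s) (a + s * (2 * j))" | "first_class (4 * - s) (a + - s * (2 * j))"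
      by (auto simp: algebra_simps)
    then show ?thesis
    proof cases
      case 1
      then show ?thesis using first_centre_two_steps[OF a j] 3 by blast
    next
      case 2
      have "a \<prec> a + - s * q"
        using first_centre_two_steps[of "- s" a q j] a j 2 3 by simp
      then show ?thesis by (rule reflect_first) (use a \<open>a \<in> A\<close> in auto)
    qed
  qed
qed

lemma first_centre:
  assumes "first_class s a" "first_class (2 * s) a" "s \<noteq> 0" "odd q" "a + s * q \<in> A" "a - s * q \<in> A"
  shows "a \<prec> a + s * q"
proof (cases "q > 0")
  case True
  then show ?thesis using first_centre_pos assms by blast
next
  case False
  then have "0 < - q" using \<open>odd q\<close> by presburger
  then show ?thesis using first_centre_pos[of "- s" a "- q"] assms by simp
qed

section \<open>The comparisons in terms of residues and mirror points\<close>

lemma odd_multiple: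
  assumes "(x - a) mod (2 * s) = (s :: int)"
  obtains q where "odd q" "x = a + s * q"
proof
  have "x - a = 2 * s * ((x - a) div (2 * s)) + s"
    using mult_div_mod_eq[of "2 * s" "x - a"] assms by simp
  then show "x = a + s * (2 * ((x - a) div (2 * s)) + 1)" by (simp add: algebra_simps)
qed simp

lemma end_prec:
  assumes "first_class s a" "s \<noteq> 0" "(b - a) mod (2 * s) = s" "a \<in> A" "b \<in> A" "2 * b - a \<in> A"
  shows "a \<prec> b"
proof -
  obtain q where q: "odd q" "b = a + s * q" using odd_multiple[OF assms(3)] .
  then have "a + s * (2 * q) = 2 * b - a" by simp
  then show ?thesis using first_end[of s a q] assms q by metis
qed

lemma inner_prec:
  assumes "first_class s a" "s \<noteq> 0" "(b - a) mod (2 * s) = s"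
    and "a \<in> A" "b \<in> A" "2 * a - b \<in> A" "3 * a - 2 * b \<in> A"
  shows "a \<prec> b"
proof -
  obtain q where q: "odd q" "b = a + s * q" using odd_multiple[OF assms(3)] .
  then have "a - s * q = 2 * a - b" "a - s * (2 * q) = 3 * a - 2 * b" by simp_all
  then show ?thesis using first_inner[of s a q] assms q by metis
qed

lemma centre_not_first:
  assumes "b \<prec> a" "first_class s a" "s \<noteq> 0" "(b - a) mod (2 * s) = s"
    and "a \<in> A" "b \<in> A" "2 * a - b \<in> A"
  shows "\<not> first_class (2 * s) a"
proof
  assume *: "first_class (2 * s) a"
  obtain q where q: "odd q" "b = a + s * q" using odd_multiple[OF assms(4)] .
  then have "a - s * q = 2 * a - b" by simp
  then have "a \<prec> b" using first_centre[of s a q] * assms q by simp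
  then show False using assms(1) prec_asym by blast
qed

lemma first_class_mod_cong:
  assumes "first_class s a" "(b - a) mod (2 * s) = 0"
  shows "first_class s b"
  using assms(1) first_class_cong[OF mod_0_imp_dvd[OF assms(2)]] by simp

lemma first_class_cases:
  assumes "s \<noteq> 0" "(b - a) mod (2 * s) = s"
  shows "first_class s a \<or> first_class s b"
proof -
  obtain q where "odd q" "b = a + s * q" using odd_multiple[OF assms(2)] .
  then show ?thesis using first_class_dichotomy_odd assms(1) by blast
qed

text \<open>One of \<open>y\<close> and \<open>z\<close> is first for \<open>2 * s\<close>, and
  \<open>first_centre\<close> would then place it before \<open>b\<close>.\<close>

lemma no_common_predecessor:
  assumes prec: "b \<prec> y" "b \<prec> z"
    and s: "first_class s y" "s > 0" "(b - y) mod (2 * s) = s" "(z - y) mod (4 * s) = 2 * s"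
    and mem: "y \<in> A" "z \<in> A" "b \<in> A" "2 * y - b \<in> A" "2 * z - b \<in> A"
  shows False
proof -
  obtain i where i: "z = y + 2 * s * i" "odd i"
    using odd_multiple[of z y "2 * s"] s(4) by auto
  have "first_class s z" using s(1) i first_class_shift by simp
  moreover have "(b - z) mod (2 * s) = s"
  proof -
    have "b - z = (b - y) + 2 * s * (- i)" using i by simp
    then show ?thesis using s(3) by (simp only: mod_mult_self2)
  qed
  ultimately have "\<not> first_class (2 * s) z" using prec s mem by (intro centre_not_first[of b]) auto
  moreover have "\<not> first_class (2 * s) y" using prec s mem by (intro centre_not_first[of b]) auto
  ultimately show False using first_class_cases[of "2 * s" z y] s(2,4) by auto
qed

end

section \<open>Case analysis on first classes for \<open>M = 8 * k\<close>\<close>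

lemma no_ap_free_order_eight_multiple:
  fixes k :: int
  assumes k: "2 \<le> k" and "ap_free_order {8 * k<..16 * k} r"
    and A1: "(16 * k - 5, 8 * k + 5) \<in> r"
    and A2: "(16 * k - 3, 8 * k + 6) \<in> r"
    and A3: "(16 * k - 10, 8 * k + 3) \<in> r"
  shows False
proof -
  interpret ap_free_order "{8 * k<..16 * k}" r by fact
  show False
  proof (cases "first_class 1 0")
    case True
    have ev: "first_class 1 a" if "even a" for a :: int
      using True that by (intro first_class_mod_cong[of 1 0 a]) auto
    \<comment> \<open>The bounds on \<open>z\<close> are exactly those that keep the mirror image of
      \<open>8 * k + 6\<close> in \<open>z\<close> inside the interval.\<close>
    have low: "16 * k - 3 \<prec> z" if "odd z" "8 * k + 4 \<le> z" "z \<le> 12 * k + 3" for z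
    proof -
      note A2
      also have "8 * k + 6 \<prec> z"
        by (rule end_prec[of 1, OF ev]) (use k that in \<open>((auto; fail) | presburger)+\<close>)
      finally show ?thesis .
    qed
    show False
    proof (cases "first_class 2 3")
      case True
      then have "first_class 2 (12 * k - 1)" by (rule first_class_mod_cong) presburger
      then show False
        by (rule no_common_predecessor[of "16 * k - 3" _ "12 * k + 3", rotated 2])
          (use k in \<open>((auto intro!: low; fail) | presburger)+\<close>)
    next
      case False
      then have "first_class 2 1" using first_class_cases[of 2 1 3] by simp
      then have c: "first_class 2 (12 * k + 1)" by (rule first_class_mod_cong) presburger
      \<comment> \<open>Reflecting in \<open>12 * k + 1\<close> and chaining with \<open>A1\<close>
        puts \<open>16 * k - 5\<close> and \<open>8 * k + 7\<close> before
        \<open>12 * k + 1\<close>.\<close>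
      have c3: "16 * k - 3 \<prec> 12 * k + 1" using k by (intro low) auto
      have "8 * k + 5 \<prec> 12 * k + 1"
        by (rule reflect_last[OF c3]) (use k in auto)
      with A1 have c5: "16 * k - 5 \<prec> 12 * k + 1" by (rule prec_trans)
      have c7: "8 * k + 7 \<prec> 12 * k + 1"
        by (rule reflect_last[OF c5]) (use k in auto)
      \<comment> \<open>Comparing \<open>12 * k + 1\<close> with \<open>16 * k - 5\<close> directly
        needs \<open>20 * k - 11 \<le> 16 * k\<close> for \<open>end_prec\<close>, so
        \<open>k = 2\<close>, or \<open>4 * k + 13 > 8 * k\<close> for \<open>inner_prec\<close>, so
        \<open>k \<le> 3\<close>.\<close>
      consider "k = 2" | "k = 3" | "k \<ge> 4" using k by linarith
      then show False
      proof cases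
        case 1
        then have "12 * k + 1 \<prec> 16 * k - 5" using c by (intro end_prec[of 2]) auto
        then show False using c5 prec_asym by blast
      next
        case 2
        then have "12 * k + 1 \<prec> 16 * k - 5" using c by (intro inner_prec[of 2]) auto
        then show False using c5 prec_asym by blast
      next
        case 3
        \<comment> \<open>The offsets lie at odd multiples of 2 from \<open>12 * k + 1\<close>. For
          offset 11 the mirror point \<open>12 * k + 21\<close> leaves the interval when
          \<open>k = 5\<close>, hence \<open>inner_prec\<close>.\<close>
        have after_c: "12 * k + 1 \<prec> 12 * k + i"
          if "i = -5 \<or> i = -1 \<or> i = 3 \<or> i = 7 \<or> (i = -9 \<or> i = 11) \<and> k \<ge> 5" for i
        proof (cases "i = 11")
          case True
          then show ?thesis using that c by (intro inner_prec[of 2]) auto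
        next
          case False
          then show ?thesis using that 3 c by (intro end_prec[of 2]) auto
        qed
        \<comment> \<open>The parity of \<open>k\<close> selects \<open>i\<close> so that
          \<open>12 * k + i\<close> is 7 modulo 8; the pair 8 apart then has the common predecessor
          \<open>16 * k - 5\<close>. In \<open>last3\<close> the residue is 3 and the predecessor
          \<open>8 * k + 7\<close>.\<close>
        have last7: False if "first_class 4 7" "i = -1 \<and> even k \<or> i = 3 \<and> odd k" for i :: int
        proof -
          have k5: "i = -1 \<or> k \<ge> 5" using that(2) 3 by presburger
          have "16 * k - 5 \<prec> 12 * k + i"
            by (rule prec_trans[OF c5 after_c]) (use that(2) 3 in presburger)
          moreover have "16 * k - 5 \<prec> 12 * k + (i + 8)"
            by (rule prec_trans[OF c5 after_c]) (use that(2) 3 in presburger)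
          moreover have "first_class 4 (12 * k + i)"
            using that(1) by (rule first_class_mod_cong) (use that(2) in presburger)
          ultimately show False
            by (rule no_common_predecessor) (use that(2) k5 3 in \<open>((auto; fail) | presburger)+\<close>)
        qed
        have last3: False if "first_class 4 3" "i = 3 \<and> even k \<or> i = -1 \<and> odd k" for i :: int
        proof -
          have k5: "i = 3 \<or> k \<ge> 5" using that(2) 3 by presburger
          have "8 * k + 7 \<prec> 12 * k + i"
            by (rule prec_trans[OF c7 after_c]) (use that(2) 3 in presburger)
          moreover have "8 * k + 7 \<prec> 12 * k + (i - 8)"
            by (rule prec_trans[OF c7 after_c]) (use that(2) 3 in presburger)
          moreover have "first_class 4 (12 * k + i)"
            using that(1) by (rule first_class_mod_cong) (use that(2) in presburger)
          ultimately show False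
            by (rule no_common_predecessor) (use that(2) k5 3 in \<open>((auto; fail) | presburger)+\<close>)
        qed
        have "first_class 4 3 \<or> first_class 4 7" by (rule first_class_cases) auto
        then show False using last3 last7 by blast
      qed
    qed
  next
    case False
    then have "first_class 1 1" using first_class_cases[of 1 0 1] by simp
    then have od: "first_class 1 a" if "odd a" for a :: int
      using that by (intro first_class_mod_cong[of 1 1 a]) (auto simp: odd_iff_mod_2_eq_one)
    show False
    proof (cases "first_class 2 0")
      case True
      then have "first_class 2 (12 * k)" by (rule first_class_mod_cong) presburger
      moreover have "16 * k - 10 \<prec> z" if "z = 12 * k \<or> z = 12 * k - 4" for z
      proof -
        note A3
        also have "8 * k + 3 \<prec> z"
          by (rule end_prec[of 1, OF od]) (use k that in \<open>((auto; fail) | presburger)+\<close>)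
        finally show ?thesis .
      qed
      ultimately show False
        by (intro no_common_predecessor[of "16 * k - 10" "12 * k" "12 * k - 4" 2]) (use k in \<open>((auto; fail) | presburger)+\<close>)
    next
      case False
      then have "first_class 2 2" using first_class_cases[of 2 0 2] by simp
      then have e: "first_class 2 (12 * k - 2)" by (rule first_class_mod_cong) presburger
      \<comment> \<open>The pair \<open>12 * k - 2\<close>, \<open>12 * k + 2\<close> is to receive
        a common predecessor divisible by 4; it suffices to put one before \<open>12 * k - 1\<close>
        or before \<open>12 * k - 3\<close>.\<close>
      have o: "12 * k - 1 \<prec> 12 * k - 2" "12 * k - 1 \<prec> 12 * k + 2"
        "12 * k - 3 \<prec> 12 * k - 2" "12 * k - 3 \<prec> 12 * k + 2"
        by (rule end_prec[of 1, OF od]; use k in \<open>((auto; fail) | presburger)+\<close>)+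
      show False
      proof (cases "first_class 2 1")
        case True
        then have "first_class 2 (8 * k + 5)" by (rule first_class_mod_cong) presburger
        then have "8 * k + 5 \<prec> 12 * k - 1" by (rule end_prec) (use k in \<open>((auto; fail) | presburger)+\<close>)
        with A1 have "16 * k - 5 \<prec> 12 * k - 1" by (rule prec_trans)
        then have "8 * k + 3 \<prec> 12 * k - 1" by (rule reflect_last) (use k in auto)
        with A3 have "16 * k - 10 \<prec> 12 * k - 1" by (rule prec_trans)
        then have "8 * k + 8 \<prec> 12 * k - 1" by (rule reflect_last) (use k in auto)
        then have "8 * k + 8 \<prec> 12 * k - 2" "8 * k + 8 \<prec> 12 * k + 2" using o prec_trans by blast+
        then show False using e by (rule no_common_predecessor) (use k in \<open>((auto; fail) | presburger)+\<close>)
      next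
        case False
        then have "first_class 2 3" using first_class_cases[of 2 1 3] by simp
        then have "first_class 2 (8 * k + 3)" by (rule first_class_mod_cong) presburger
        then have "8 * k + 3 \<prec> 12 * k - 3" by (rule end_prec) (use k in \<open>((auto; fail) | presburger)+\<close>)
        with A3 have "16 * k - 10 \<prec> 12 * k - 3" by (rule prec_trans)
        then have "8 * k + 4 \<prec> 12 * k - 3" by (rule reflect_last) (use k in auto)
        then have "8 * k + 4 \<prec> 12 * k - 2" "8 * k + 4 \<prec> 12 * k + 2" using o prec_trans by blast+
        then show False using e by (rule no_common_predecessor) (use k in \<open>((auto; fail) | presburger)+\<close>)
      qed
    qed
  qed
qed

theorem theorem22:
  fixes M :: int
  assumes "M \<ge> 16" and "M mod 8 = 0"
  shows "\<not> (\<exists>r. linear_ordering_of {M<..2 * M} r \<and> AP_free_on {M<..2 * M} r \<and>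
    (2 * M - 5, M + 5) \<in> r \<and> (2 * M - 3, M + 6) \<in> r \<and> (2 * M - 10, M + 3) \<in> r)"
proof
  assume "\<exists>r. linear_ordering_of {M<..2 * M} r \<and> AP_free_on {M<..2 * M} r \<and>
    (2 * M - 5, M + 5) \<in> r \<and> (2 * M - 3, M + 6) \<in> r \<and> (2 * M - 10, M + 3) \<in> r"
  then obtain r where r: "linear_ordering_of {M<..2 * M} r" "AP_free_on {M<..2 * M} r"
    "(2 * M - 5, M + 5) \<in> r" "(2 * M - 3, M + 6) \<in> r" "(2 * M - 10, M + 3) \<in> r" by blast
  obtain k where k: "M = 8 * k" using \<open>M mod 8 = 0\<close> by (auto simp: mod_eq_0_iff_dvd)
  have "ap_free_order {8 * k<..16 * k} r"
    using r k by unfold_locales auto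
  then show False
    using no_ap_free_order_eight_multiple[of k r] r \<open>M \<ge> 16\<close> k by simp
qed

end
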